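(* Let $\Phi_1,\Phi_2$ be point processes on $\mathbb{R}^d$ whose product intensities of order one and two exist, and let $g_1,g_2$ be their pair correlation functions. If $\Phi_1\le_{dcx}\Phi_2$, then $g_1(x,y)\le g_2(x,y)$ for almost every $(x,y)$ with respect to Lebesgue measure (where the pair correlation functions are defined).
   Context: A function $f:\mathbb{R}^n\to\mathbb{R}$ is directionally convex (dcx) if $f(x)+f(y)\le f(p)+f(q)$ whenever $p\le x,y\le q$ (componentwise) and $x+y=p+q$. For random vectors $X,Y$ of the same dimension, $X\le_{dcx}Y$ means $E f(X)\le E f(Y)$ for all dcx $f$ for which both expectations are finite. For point processes (random locally finite counting measures), $\Phi_1\le_{dcx}\Phi_2$ means $(\Phi_1(I_1),\dots,\Phi_1(I_n))\le_{dcx}(\Phi_2(I_1),\dots,\Phi_2(I_n))$ for all $n\ge1$ and all bounded Borel $I_1,\dots,I_n$. The $k$-th moment measure of $\Phi$ is $\alpha^k(\cdot)=E(\Phi^k(\cdot))$ on $(\mathbb{R}^d)^k$, where $\Phi^k(A_1\times\dots\times A_k)=\prod_j\Phi(A_j)$; moments are assumed finite on bounded sets. The $k$-th product intensity $\rho_k$ is, outside the diagonals, the density of $\alpha^k$ with respect to Lebesgue measure. The pair correlation function is $g(x,y)=\dfrac{\rho_2(x,y)}{\rho_1(x)\rho_1(y)}$, defined where $\rho_1(x)\rho_1(y)>0$. *)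

theory Defs
  imports "HOL-Probability.Probability"
begin

definition lf_counting_measure :: "'a::euclidean_space measure \<Rightarrow> bool" where
  "lf_counting_measure N \<longleftrightarrow>
     sets N = sets borel \<and>
     (\<forall>A\<in>sets borel. bounded A \<longrightarrow> (\<exists>m::nat. emeasure N A = of_nat m))"

text \<open>Measurability of all evaluation maps is measurability with respect to the usual
  \<open>\<sigma>\<close>-algebra on the space of locally finite counting measures.\<close>

definition point_process :: "'w measure \<Rightarrow> ('w \<Rightarrow> 'a::euclidean_space measure) \<Rightarrow> bool" where
  "point_process M \<Phi> \<longleftrightarrow>
     prob_space M \<and>
     (\<forall>\<omega>\<in>space M. lf_counting_measure (\<Phi> \<omega>)) \<and>
     (\<forall>A\<in>sets borel. (\<lambda>\<omega>. emeasure (\<Phi> \<omega>) A) \<in> borel_measurable M)"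

text \<open>For every type \<open>'b\<close>, the space \<open>'b\<^sup>n\<close> is represented by the extensional functions
  \<open>{..<n} \<rightarrow>\<^sub>E UNIV\<close>, the carrier of \<open>Pi\<^sub>M {..<n}\<close>.\<close>

definition dcx :: "nat \<Rightarrow> ((nat \<Rightarrow> real) \<Rightarrow> real) \<Rightarrow> bool" where
  "dcx n f \<longleftrightarrow>
     (\<forall>x y p q. x \<in> {..<n} \<rightarrow>\<^sub>E UNIV \<and> y \<in> {..<n} \<rightarrow>\<^sub>E UNIV \<and>
        p \<in> {..<n} \<rightarrow>\<^sub>E UNIV \<and> q \<in> {..<n} \<rightarrow>\<^sub>E UNIV \<and>
        (\<forall>i<n. p i \<le> x i \<and> x i \<le> q i \<and> p i \<le> y i \<and> y i \<le> q i \<and> x i + y i = p i + q i)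
        \<longrightarrow> f x + f y \<le> f p + f q)"

definition dcx_le ::
  "nat \<Rightarrow> 'v measure \<Rightarrow> ('v \<Rightarrow> nat \<Rightarrow> real) \<Rightarrow> 'w measure \<Rightarrow> ('w \<Rightarrow> nat \<Rightarrow> real) \<Rightarrow> bool" where
  "dcx_le n M X N Y \<longleftrightarrow>
     (\<forall>f. dcx n f \<and> integrable M (\<lambda>\<omega>. f (X \<omega>)) \<and> integrable N (\<lambda>\<omega>. f (Y \<omega>))
        \<longrightarrow> (\<integral>\<omega>. f (X \<omega>) \<partial>M) \<le> (\<integral>\<omega>. f (Y \<omega>) \<partial>N))"

definition count_vector ::
  "('w \<Rightarrow> 'a measure) \<Rightarrow> nat \<Rightarrow> (nat \<Rightarrow> 'a set) \<Rightarrow> 'w \<Rightarrow> nat \<Rightarrow> real" where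
  "count_vector \<Phi> n I \<omega> = (\<lambda>i\<in>{..<n}. measure (\<Phi> \<omega>) (I i))"

definition pp_dcx_le ::
  "'v measure \<Rightarrow> ('v \<Rightarrow> 'a::euclidean_space measure) \<Rightarrow>
   'w measure \<Rightarrow> ('w \<Rightarrow> 'a measure) \<Rightarrow> bool" where
  "pp_dcx_le M \<Phi> N \<Psi> \<longleftrightarrow>
     (\<forall>n\<ge>1. \<forall>I. (\<forall>i<n. I i \<in> sets borel \<and> bounded (I i))
        \<longrightarrow> dcx_le n M (count_vector \<Phi> n I) N (count_vector \<Psi> n I))"

text \<open>The moment measure is given by its values on the sets of
  \<open>Pi\<^sub>M {..<k} (\<lambda>_. borel)\<close>.\<close>

definition moment_measure ::
  "'w measure \<Rightarrow> ('w \<Rightarrow> 'a::euclidean_space measure) \<Rightarrow> nat \<Rightarrow> (nat \<Rightarrow> 'a) set \<Rightarrow> ennreal" where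
  "moment_measure M \<Phi> k B = (\<integral>\<^sup>+\<omega>. emeasure (Pi\<^sub>M {..<k} (\<lambda>_. \<Phi> \<omega>)) B \<partial>M)"

text \<open>Every bounded subset of the \<open>k\<close>-fold product lies in a cube \<open>A\<^sup>k\<close> with \<open>A\<close> bounded. (The
  predicate \<^const>\<open>bounded\<close> on \<^typ>\<open>nat \<Rightarrow> 'a\<close> itself refers to a bounded metric and would
  hold of every set.)\<close>

definition moment_finite ::
  "'w measure \<Rightarrow> ('w \<Rightarrow> 'a::euclidean_space measure) \<Rightarrow> nat \<Rightarrow> bool" where
  "moment_finite M \<Phi> k \<longleftrightarrow>
     (\<forall>A\<in>sets borel. bounded A \<longrightarrow> moment_measure M \<Phi> k ({..<k} \<rightarrow>\<^sub>E A) < \<infinity>)"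

definition product_intensity ::
  "'w measure \<Rightarrow> ('w \<Rightarrow> 'a::euclidean_space measure) \<Rightarrow> nat \<Rightarrow> ((nat \<Rightarrow> 'a) \<Rightarrow> real) \<Rightarrow> bool" where
  "product_intensity M \<Phi> k \<rho> \<longleftrightarrow>
     \<rho> \<in> borel_measurable (Pi\<^sub>M {..<k} (\<lambda>_. borel)) \<and>
     (\<forall>x\<in>{..<k} \<rightarrow>\<^sub>E UNIV. 0 \<le> \<rho> x) \<and>
     (\<forall>B\<in>sets (Pi\<^sub>M {..<k} (\<lambda>_. borel)). B \<subseteq> {x. inj_on x {..<k}} \<longrightarrow>
        moment_measure M \<Phi> k B = (\<integral>\<^sup>+x\<in>B. ennreal (\<rho> x) \<partial>(Pi\<^sub>M {..<k} (\<lambda>_. lborel))))"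

definition tuple1 :: "'a \<Rightarrow> nat \<Rightarrow> 'a" where
  "tuple1 x = (\<lambda>i\<in>{..<1}. x)"

definition tuple2 :: "'a \<Rightarrow> 'a \<Rightarrow> nat \<Rightarrow> 'a" where
  "tuple2 x y = (\<lambda>i\<in>{..<2}. if i = 0 then x else y)"

definition pair_correlation ::
  "((nat \<Rightarrow> 'a) \<Rightarrow> real) \<Rightarrow> ((nat \<Rightarrow> 'a) \<Rightarrow> real) \<Rightarrow> 'a \<Rightarrow> 'a \<Rightarrow> real" where
  "pair_correlation \<rho>\<^sub>1 \<rho>\<^sub>2 x y = \<rho>\<^sub>2 (tuple2 x y) / (\<rho>\<^sub>1 (tuple1 x) * \<rho>\<^sub>1 (tuple1 y))"

definition pair_correlation_defined :: "((nat \<Rightarrow> 'a) \<Rightarrow> real) \<Rightarrow> 'a \<Rightarrow> 'a \<Rightarrow> bool" where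
  "pair_correlation_defined \<rho>\<^sub>1 x y \<longleftrightarrow> \<rho>\<^sub>1 (tuple1 x) * \<rho>\<^sub>1 (tuple1 y) > 0"

lemma lf_counting_measure_sigma_finite:
  fixes N :: "'a::euclidean_space measure"
  assumes "lf_counting_measure N"
  shows "sigma_finite_measure N"
proof
  have s: "sets N = sets borel"
    using assms by (simp add: lf_counting_measure_def)
  have f: "emeasure N A \<noteq> \<infinity>" if "A \<in> sets borel" "bounded A" for A
    using assms that unfolding lf_counting_measure_def
    by (metis ennreal_of_nat_neq_top infinity_ennreal_def)
  have "(\<Union>i::nat. ball (0::'a) (real i)) = UNIV"
    by (auto intro: reals_Archimedean2)
  moreover have "space N = UNIV"
    using sets_eq_imp_space_eq[OF s] by simp
  ultimately show "\<exists>A. countable A \<and> A \<subseteq> sets N \<and> \<Union> A = space N \<and> (\<forall>a\<in>A. emeasure N a \<noteq> \<infinity>)"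
    by (intro exI[of _ "range (\<lambda>i::nat. ball (0::'a) (real i))"]) (use f in \<open>auto simp: s\<close>)
qed

lemma moment_measure_box:
  assumes "point_process M \<Phi>" and "\<And>i. i < k \<Longrightarrow> A i \<in> sets borel"
  shows "moment_measure M \<Phi> k (Pi\<^sub>E {..<k} A) = (\<integral>\<^sup>+\<omega>. (\<Prod>i<k. emeasure (\<Phi> \<omega>) (A i)) \<partial>M)"
  unfolding moment_measure_def
proof (rule nn_integral_cong)
  fix \<omega> assume "\<omega> \<in> space M"
  with assms(1) have N: "lf_counting_measure (\<Phi> \<omega>)"
    by (simp add: point_process_def)
  interpret product_sigma_finite "\<lambda>_::nat. \<Phi> \<omega>"
    by (simp add: product_sigma_finite_def lf_counting_measure_sigma_finite[OF N])
  show "emeasure (Pi\<^sub>M {..<k} (\<lambda>_. \<Phi> \<omega>)) (Pi\<^sub>E {..<k} A) = (\<Prod>i<k. emeasure (\<Phi> \<omega>) (A i))"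
    using N assms(2) by (intro emeasure_PiM) (auto simp: lf_counting_measure_def)
qed

end

theory Submission
  imports Defs
begin

text \<open>
  Directional convexity of a function controls its mixed second differences in non-negative
  directions, so the order sees two kinds of moments of counts. The functions \<open>x\<close> and
  \<open>- x\<close> of one variable are both dcx, hence \<open>\<Phi>\<^sub>1\<close> and \<open>\<Phi>\<^sub>2\<close> have the same mean measure on
  bounded sets, and their first intensities agree almost everywhere. The product \<open>x\<^sub>0 x\<^sub>1\<close> is dcx,
  hence \<open>E \<Phi>\<^sub>1(A) \<Phi>\<^sub>1(B) \<le> E \<Phi>\<^sub>2(A) \<Phi>\<^sub>2(B)\<close> for bounded \<open>A\<close> and \<open>B\<close>. The pair correlations
  thus have the same denominators, and it remains to compare the second intensities.

  A second intensity is the density of the second moment measure off the diagonal only. On a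
  product \<open>U \<times> V\<close> of disjoint bounded open sets the moment inequality compares the integrals
  of the two densities over all Borel rectangles. Rectangles generate the Borel sets, but an
  inequality, unlike an equality, does not pass through a Dynkin system argument, since proper
  differences need not preserve it. Instead, the inequality passes to finite unions of rectangles
  (which are finite \<^emph>\<open>disjoint\<close> unions), from there to open sets by monotone limits, and to
  Borel sets by outer regularity (lemma \<open>emeasure_le_of_borel_rectangles\<close>). So the densities
  are ordered almost everywhere on \<open>U \<times> V\<close>. Countably many such products cover the
  complement of the diagonal, which is a Lebesgue null set.
\<close>

section \<open>Comparing measures and densities\<close>

text \<open>On the set where \<open>g < f\<close>, the function \<open>f - g\<close> is positive but has integral \<open>0\<close>, so
  that this set is null. Finiteness makes the subtraction of the integrals legitimate.\<close>

lemma AE_le_of_set_nn_integral_le: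
  fixes f g :: "'b \<Rightarrow> ennreal"
  assumes f [measurable]: "f \<in> borel_measurable M" and g [measurable]: "g \<in> borel_measurable M"
    and fin: "(\<integral>\<^sup>+x. f x \<partial>M) < \<infinity>"
    and le: "\<And>A. A \<in> sets M \<Longrightarrow> (\<integral>\<^sup>+x\<in>A. f x \<partial>M) \<le> (\<integral>\<^sup>+x\<in>A. g x \<partial>M)"
  shows "AE x in M. f x \<le> g x"
proof -
  define S where "S = {x \<in> space M. g x < f x}"
  have S [measurable]: "S \<in> sets M"
    unfolding S_def by measurable
  have gf: "g x * indicator S x \<le> f x * indicator S x" for x
    by (auto simp: S_def indicator_def)
  have "(\<integral>\<^sup>+x\<in>S. g x \<partial>M) \<le> (\<integral>\<^sup>+x\<in>S. f x \<partial>M)"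
    by (intro nn_integral_mono gf)
  also have "\<dots> \<le> (\<integral>\<^sup>+x. f x \<partial>M)"
    by (intro nn_integral_mono) (auto simp: indicator_def)
  finally have g_fin: "(\<integral>\<^sup>+x\<in>S. g x \<partial>M) < \<infinity>"
    using fin by (rule le_less_trans)
  have "(\<integral>\<^sup>+x. f x * indicator S x - g x * indicator S x \<partial>M)
      = (\<integral>\<^sup>+x\<in>S. f x \<partial>M) - (\<integral>\<^sup>+x\<in>S. g x \<partial>M)"
    using g_fin gf by (intro nn_integral_diff) auto
  also have "\<dots> = 0"
    using le[OF S] g_fin by (auto simp: diff_eq_0_iff_ennreal intro: le_less_trans)
  finally have "AE x in M. f x * indicator S x - g x * indicator S x = 0"
    by (subst (asm) nn_integral_0_iff_AE) auto
  then show ?thesis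
  proof (rule AE_mp, intro AE_I2 impI)
    fix x assume x: "x \<in> space M" and "f x * indicator S x - g x * indicator S x = 0"
    then have "f x * indicator S x \<le> g x * indicator S x"
      by (metis diff_gr0_ennreal not_le less_irrefl)
    with x show "f x \<le> g x"
      by (cases "x \<in> S") (auto simp: S_def)
  qed
qed

lemma semiring_of_borel_rectangles:
  "semiring_of_sets UNIV
     {A \<times> B |A B. A \<in> sets (borel :: 'a::topological_space measure)
                \<and> B \<in> sets (borel :: 'b::topological_space measure)}"
  (is "semiring_of_sets _ ?R")
proof
  show "?R \<subseteq> Pow UNIV" by simp
  show "{} \<in> ?R" by blast
  fix a b assume "a \<in> ?R" "b \<in> ?R"
  then obtain A B C D where
    m: "A \<in> sets borel" "B \<in> sets borel" "C \<in> sets borel" "D \<in> sets borel"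
    and ab: "a = A \<times> B" "b = C \<times> D"
    by blast
  have "a \<inter> b = (A \<inter> C) \<times> (B \<inter> D)"
    unfolding ab by blast
  with m show "a \<inter> b \<in> ?R"
    by (blast intro: sets.Int)
  \<comment> \<open>A point of \<open>A \<times> B\<close> leaves \<open>C \<times> D\<close> either through its first coordinate, or through
    its second one alone.\<close>
  let ?C = "{(A - C) \<times> B, (A \<inter> C) \<times> (B - D)}"
  have "(A - C) \<times> B \<in> ?R" "(A \<inter> C) \<times> (B - D) \<in> ?R"
    using m by (blast intro: sets.Diff sets.Int)+
  then have "?C \<subseteq> ?R"
    by simp
  moreover have "disjoint ?C"
    by (auto simp: disjoint_def)
  moreover have "a - b = \<Union>?C"
    unfolding ab by auto
  ultimately show "\<exists>C\<subseteq>?R. finite C \<and> disjoint C \<and> a - b = \<Union>C"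
    by (intro exI[of _ ?C] conjI) simp_all
qed

text \<open>The sets on which one measure is below another are closed under disjoint unions and
  monotone limits, but not under differences. Open sets are reached from rectangles by these
  operations alone, since the ring generated by a semiring consists of finite disjoint unions;
  outer regularity of \<open>\<nu>\<close>, a finite measure on a Polish space, does the rest.\<close>

lemma emeasure_le_of_borel_rectangles:
  fixes \<mu> \<nu> :: "('a::polish_space \<times> 'b::polish_space) measure"
  assumes sets: "sets \<mu> = sets borel" "sets \<nu> = sets borel"
    and fin: "emeasure \<nu> (space \<nu>) < \<infinity>"
    and le: "\<And>A B. A \<in> sets borel \<Longrightarrow> B \<in> sets borel \<Longrightarrow> emeasure \<mu> (A \<times> B) \<le> emeasure \<nu> (A \<times> B)"
    and E: "E \<in> sets borel"
  shows "emeasure \<mu> E \<le> emeasure \<nu> E"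
proof -
  define R :: "('a \<times> 'b) set set" where "R = {A \<times> B |A B. A \<in> sets borel \<and> B \<in> sets borel}"
  interpret semiring_of_sets UNIV R
    unfolding R_def by (rule semiring_of_borel_rectangles)
  have R_borel: "R \<subseteq> sets borel"
    by (auto simp: R_def intro: borel_Times)
  have R_le: "emeasure \<mu> c \<le> emeasure \<nu> c" if "c \<in> R" for c
    using that le by (auto simp: R_def)
  have ring_le: "emeasure \<mu> a \<le> emeasure \<nu> a" if "a \<in> generated_ring" for a
  proof -
    from that obtain C where C: "finite C" "disjoint C" "C \<subseteq> R" "a = \<Union>C"
      by (rule generated_ringE)
    then have add: "emeasure N a = (\<Sum>c\<in>C. emeasure N c)" if "sets N = sets borel" for N
      using that R_borel sum_emeasure[of "\<lambda>c. c" C N]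
      by (auto simp: disjoint_family_on_def disjoint_def)
    show ?thesis
      unfolding add[OF sets(1)] add[OF sets(2)] using C R_le by (intro sum_mono) auto
  qed
  have open_le: "emeasure \<mu> U \<le> emeasure \<nu> U" if "open U" for U
  proof (cases "U = {}")
    case False
    obtain \<A> :: "'a set set" where A: "countable \<A>" "topological_basis \<A>"
      using ex_countable_basis by blast
    obtain \<B> :: "'b set set" where B: "countable \<B>" "topological_basis \<B>"
      using ex_countable_basis by blast
    have "topological_basis ((\<lambda>(a, b). a \<times> b) ` (\<A> \<times> \<B>))"
      using A B by (intro topological_basis_prod)
    then obtain C where C: "C \<subseteq> (\<lambda>(a, b). a \<times> b) ` (\<A> \<times> \<B>)" "U = \<Union>C"
      using \<open>open U\<close> unfolding topological_basis_def by blast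
    have "countable C"
      by (rule countable_subset[OF C(1)]) (simp add: A(1) B(1))
    moreover have "C \<noteq> {}"
      using C False by auto
    ultimately have c: "range (from_nat_into C) = C"
      by (rule range_from_nat_into[rotated])
    have A_borel: "a \<in> sets borel" if "a \<in> \<A>" for a
      using A(2) that by (simp add: topological_basis_open)
    have B_borel: "b \<in> sets borel" if "b \<in> \<B>" for b
      using B(2) that by (simp add: topological_basis_open)
    have CR: "from_nat_into C i \<in> R" for i
    proof -
      have "from_nat_into C i \<in> (\<lambda>(a, b). a \<times> b) ` (\<A> \<times> \<B>)"
        using C(1) c by blast
      then show ?thesis
        using A_borel B_borel unfolding R_def by auto
    qed
    interpret ring: ring_of_sets UNIV generated_ring
      by (rule generating_ring)
    \<comment> \<open>The rectangles that make up \<open>U\<close> may overlap, but each finite union of them lies in the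
      ring of finite disjoint unions.\<close>
    define D where "D n = (\<Union>i<n. from_nat_into C i)" for n
    have D_ring: "D n \<in> generated_ring" for n
      unfolding D_def using CR by (intro ring.finite_UN) (auto intro: generated_ringI_Basic)
    have D_borel: "D n \<in> sets borel" for n
      unfolding D_def using CR R_borel by (intro sets.finite_UN) auto
    have D_inc: "incseq D"
      unfolding D_def by (intro monoI UN_mono) auto
    have D_U: "(\<Union>n. D n) = U"
      unfolding D_def C(2) by (subst (2) c[symmetric]) blast
    have "emeasure \<mu> U = (SUP n. emeasure \<mu> (D n))"
      using D_borel D_inc sets by (subst SUP_emeasure_incseq) (auto simp: D_U)
    also have "\<dots> \<le> (SUP n. emeasure \<nu> (D n))"
      by (intro SUP_mono') (rule ring_le[OF D_ring])
    also have "\<dots> = emeasure \<nu> U"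
      using D_borel D_inc sets by (subst SUP_emeasure_incseq) (auto simp: D_U)
    finally show ?thesis .
  qed simp
  have "emeasure \<mu> E \<le> (INF U\<in>{U. E \<subseteq> U \<and> open U}. emeasure \<nu> U)"
  proof (rule INF_greatest)
    fix U assume "U \<in> {U. E \<subseteq> U \<and> open U}"
    then have "emeasure \<mu> E \<le> emeasure \<mu> U"
      using sets by (intro emeasure_mono) auto
    also have "\<dots> \<le> emeasure \<nu> U"
      using \<open>U \<in> _\<close> by (intro open_le) auto
    finally show "emeasure \<mu> E \<le> emeasure \<nu> U" .
  qed
  also have "\<dots> = emeasure \<nu> E"
    using fin by (intro outer_regular[symmetric] sets E) auto
  finally show ?thesis .
qed

lemma AE_le_of_rectangle_integrals_le:
  fixes f g :: "'a::euclidean_space \<times> 'b::euclidean_space \<Rightarrow> ennreal"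
  assumes [measurable]: "f \<in> borel_measurable borel" "g \<in> borel_measurable borel"
    and UV: "U \<in> sets borel" "V \<in> sets borel"
    and fin: "(\<integral>\<^sup>+z\<in>U \<times> V. g z \<partial>lborel) < \<infinity>"
    and le: "\<And>A B. A \<in> sets borel \<Longrightarrow> B \<in> sets borel \<Longrightarrow> A \<subseteq> U \<Longrightarrow> B \<subseteq> V \<Longrightarrow>
       (\<integral>\<^sup>+z\<in>A \<times> B. f z \<partial>lborel) \<le> (\<integral>\<^sup>+z\<in>A \<times> B. g z \<partial>lborel)"
  shows "AE z in lborel. z \<in> U \<times> V \<longrightarrow> f z \<le> g z"
proof -
  have [measurable]: "U \<times> V \<in> sets borel"
    using UV by (rule borel_Times)
  define f' g' where "f' z = f z * indicator (U \<times> V) z" and "g' z = g z * indicator (U \<times> V) z" for z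
  have [measurable]: "f' \<in> borel_measurable borel" "g' \<in> borel_measurable borel"
    unfolding f'_def g'_def by measurable
  have E_le: "(\<integral>\<^sup>+z\<in>E. f' z \<partial>lborel) \<le> (\<integral>\<^sup>+z\<in>E. g' z \<partial>lborel)" if E: "E \<in> sets lborel" for E
  proof -
    have "emeasure (density lborel f') E \<le> emeasure (density lborel g') E"
    proof (rule emeasure_le_of_borel_rectangles)
      show "emeasure (density lborel g') (space (density lborel g')) < \<infinity>"
        using fin by (simp add: emeasure_density g'_def)
      fix A :: "'a set" and B :: "'b set" assume AB: "A \<in> sets borel" "B \<in> sets borel"
      have *: "emeasure (density lborel (\<lambda>z. h z * indicator (U \<times> V) z)) (A \<times> B)
          = (\<integral>\<^sup>+z\<in>(A \<inter> U) \<times> (B \<inter> V). h z \<partial>lborel)"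
        if [measurable]: "h \<in> borel_measurable borel" for h
        using borel_Times[OF AB]
        by (subst emeasure_density)
          (auto intro!: nn_integral_cong simp: indicator_def)
      show "emeasure (density lborel f') (A \<times> B) \<le> emeasure (density lborel g') (A \<times> B)"
        unfolding f'_def g'_def using AB UV by (subst (1 2) *) (auto intro!: le)
    qed (use E in simp_all)
    then show ?thesis
      using E by (simp add: emeasure_density)
  qed
  have "AE z in lborel. f' z \<le> g' z"
  proof (rule AE_le_of_set_nn_integral_le)
    show "(\<integral>\<^sup>+z. f' z \<partial>lborel) < \<infinity>"
      using E_le[of UNIV] fin by (simp add: g'_def)
  qed (use E_le in auto)
  then show ?thesis
    by (rule AE_mp) (auto intro!: AE_I2 simp: f'_def g'_def indicator_def)
qed

section \<open>Moments of counts under the directionally convex order\<close>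

lemma point_process_finite_count:
  assumes "point_process M \<Phi>" "A \<in> sets borel" "bounded A" "\<omega> \<in> space M"
  shows "emeasure (\<Phi> \<omega>) A = ennreal (measure (\<Phi> \<omega>) A)"
proof (rule emeasure_eq_ennreal_measure)
  have "lf_counting_measure (\<Phi> \<omega>)"
    using assms by (simp add: point_process_def)
  then obtain m :: nat where "emeasure (\<Phi> \<omega>) A = of_nat m"
    using assms unfolding lf_counting_measure_def by blast
  then show "emeasure (\<Phi> \<omega>) A \<noteq> \<top>"
    by simp
qed

lemma point_process_measurable_emeasure:
  "point_process M \<Phi> \<Longrightarrow> A \<in> sets borel \<Longrightarrow> (\<lambda>\<omega>. emeasure (\<Phi> \<omega>) A) \<in> borel_measurable M"
  by (simp add: point_process_def)

lemma point_process_measurable_measure: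
  "point_process M \<Phi> \<Longrightarrow> A \<in> sets borel \<Longrightarrow> (\<lambda>\<omega>. measure (\<Phi> \<omega>) A) \<in> borel_measurable M"
  unfolding measure_def
  by (intro borel_measurable_enn2real point_process_measurable_emeasure)

lemma moment_measure_1:
  assumes "point_process M \<Phi>" "A \<in> sets borel"
  shows "moment_measure M \<Phi> 1 (\<Pi>\<^sub>E i\<in>{..<1}. A) = (\<integral>\<^sup>+\<omega>. emeasure (\<Phi> \<omega>) A \<partial>M)"
  using assms by (subst moment_measure_box) auto

lemma moment_measure_2:
  assumes "point_process M \<Phi>" "A \<in> sets borel" "B \<in> sets borel"
  shows "moment_measure M \<Phi> 2 (\<Pi>\<^sub>E i\<in>{..<2}. if i = 0 then A else B)
    = (\<integral>\<^sup>+\<omega>. emeasure (\<Phi> \<omega>) A * emeasure (\<Phi> \<omega>) B \<partial>M)"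
  using assms by (subst moment_measure_box) (auto simp: numeral_2_eq_2 lessThan_Suc mult.commute)

lemma first_moment_finite:
  assumes "point_process M \<Phi>" "moment_finite M \<Phi> 1" "A \<in> sets borel" "bounded A"
  shows "(\<integral>\<^sup>+\<omega>. emeasure (\<Phi> \<omega>) A \<partial>M) < \<infinity>"
  using assms(2-) moment_measure_1[OF assms(1,3)] unfolding moment_finite_def by metis

text \<open>Finite moments are only given for cubes; the rectangle \<open>A \<times> B\<close> lies in the cube over
  \<open>A \<union> B\<close>.\<close>

lemma second_moment_finite:
  assumes pp: "point_process M \<Phi>" and mf: "moment_finite M \<Phi> 2"
    and AB: "A \<in> sets borel" "bounded A" "B \<in> sets borel" "bounded B"
  shows "(\<integral>\<^sup>+\<omega>. emeasure (\<Phi> \<omega>) A * emeasure (\<Phi> \<omega>) B \<partial>M) < \<infinity>"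
proof -
  let ?C = "A \<union> B"
  have C: "?C \<in> sets borel" "bounded ?C"
    using AB by auto
  have "(\<integral>\<^sup>+\<omega>. emeasure (\<Phi> \<omega>) A * emeasure (\<Phi> \<omega>) B \<partial>M)
      \<le> (\<integral>\<^sup>+\<omega>. emeasure (\<Phi> \<omega>) ?C * emeasure (\<Phi> \<omega>) ?C \<partial>M)"
    using pp C by (intro nn_integral_mono mult_mono emeasure_mono)
      (auto simp: point_process_def lf_counting_measure_def)
  also have "\<dots> = moment_measure M \<Phi> 2 (\<Pi>\<^sub>E i\<in>{..<2}. ?C)"
    using moment_measure_2[OF pp C(1) C(1)] by simp
  also have "\<dots> < \<infinity>"
    using mf C unfolding moment_finite_def by blast
  finally show ?thesis .
qed

lemma
  assumes pp: "point_process M \<Phi>" and mf: "moment_finite M \<Phi> 1" and A: "A \<in> sets borel" "bounded A"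
  shows integrable_count: "integrable M (\<lambda>\<omega>. measure (\<Phi> \<omega>) A)"
    and nn_integral_count:
      "(\<integral>\<^sup>+\<omega>. emeasure (\<Phi> \<omega>) A \<partial>M) = ennreal (\<integral>\<omega>. measure (\<Phi> \<omega>) A \<partial>M)"
proof -
  have eq: "(\<integral>\<^sup>+\<omega>. emeasure (\<Phi> \<omega>) A \<partial>M) = (\<integral>\<^sup>+\<omega>. ennreal (measure (\<Phi> \<omega>) A) \<partial>M)"
    by (intro nn_integral_cong point_process_finite_count[OF pp A])
  show int: "integrable M (\<lambda>\<omega>. measure (\<Phi> \<omega>) A)"
    using point_process_measurable_measure[OF pp A(1)] first_moment_finite[OF pp mf A]
    by (intro integrableI_nonneg) (auto simp: eq)
  show "(\<integral>\<^sup>+\<omega>. emeasure (\<Phi> \<omega>) A \<partial>M) = ennreal (\<integral>\<omega>. measure (\<Phi> \<omega>) A \<partial>M)"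
    unfolding eq by (intro nn_integral_eq_integral int) auto
qed

lemma
  assumes pp: "point_process M \<Phi>" and mf: "moment_finite M \<Phi> 2"
    and AB: "A \<in> sets borel" "bounded A" "B \<in> sets borel" "bounded B"
  shows integrable_count_product: "integrable M (\<lambda>\<omega>. measure (\<Phi> \<omega>) A * measure (\<Phi> \<omega>) B)"
    and nn_integral_count_product: "(\<integral>\<^sup>+\<omega>. emeasure (\<Phi> \<omega>) A * emeasure (\<Phi> \<omega>) B \<partial>M)
      = ennreal (\<integral>\<omega>. measure (\<Phi> \<omega>) A * measure (\<Phi> \<omega>) B \<partial>M)"
proof -
  have eq: "(\<integral>\<^sup>+\<omega>. emeasure (\<Phi> \<omega>) A * emeasure (\<Phi> \<omega>) B \<partial>M)
      = (\<integral>\<^sup>+\<omega>. ennreal (measure (\<Phi> \<omega>) A * measure (\<Phi> \<omega>) B) \<partial>M)"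
    using point_process_finite_count[OF pp AB(1,2)] point_process_finite_count[OF pp AB(3,4)]
    by (intro nn_integral_cong) (simp add: ennreal_mult)
  show int: "integrable M (\<lambda>\<omega>. measure (\<Phi> \<omega>) A * measure (\<Phi> \<omega>) B)"
    using point_process_measurable_measure[OF pp AB(1)]
      point_process_measurable_measure[OF pp AB(3)] second_moment_finite[OF pp mf AB]
    by (intro integrableI_nonneg) (auto simp: eq)
  show "(\<integral>\<^sup>+\<omega>. emeasure (\<Phi> \<omega>) A * emeasure (\<Phi> \<omega>) B \<partial>M)
      = ennreal (\<integral>\<omega>. measure (\<Phi> \<omega>) A * measure (\<Phi> \<omega>) B \<partial>M)"
    unfolding eq by (intro nn_integral_eq_integral int) auto
qed

text \<open>The coefficient \<open>c\<close> may be negative: \<open>c = 1\<close> and \<open>c = -1\<close> together make the order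
  preserve means.\<close>

lemma dcx_linear: "dcx 1 (\<lambda>x. c * x 0)"
  unfolding dcx_def
proof (intro allI impI, elim conjE)
  fix x y p q :: "nat \<Rightarrow> real"
  assume "\<forall>i<1. p i \<le> x i \<and> x i \<le> q i \<and> p i \<le> y i \<and> y i \<le> q i \<and> x i + y i = p i + q i"
  then have "x 0 + y 0 = p 0 + q 0"
    by simp
  then show "c * x 0 + c * y 0 \<le> c * p 0 + c * q 0"
    by (metis distrib_left order_refl)
qed

text \<open>With \<open>x = p + a\<close>, \<open>y = p + b\<close> and \<open>q = p + a + b\<close>, where \<open>a, b \<ge> 0\<close>, the difference of
  the two sides is \<open>a\<^sub>0 b\<^sub>1 + b\<^sub>0 a\<^sub>1\<close>.\<close>

lemma dcx_product: "dcx 2 (\<lambda>x. x 0 * x 1)"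
  unfolding dcx_def
proof (intro allI impI, elim conjE)
  fix x y p q :: "nat \<Rightarrow> real"
  assume *: "\<forall>i<2. p i \<le> x i \<and> x i \<le> q i \<and> p i \<le> y i \<and> y i \<le> q i \<and> x i + y i = p i + q i"
  have q: "q 0 = x 0 + y 0 - p 0" "q 1 = x 1 + y 1 - p 1"
    using *[rule_format, of 0] *[rule_format, of 1] by auto
  have "0 \<le> (x 0 - p 0) * (y 1 - p 1) + (y 0 - p 0) * (x 1 - p 1)"
    using *[rule_format, of 0] *[rule_format, of 1] by (intro add_nonneg_nonneg mult_nonneg_nonneg) auto
  then show "x 0 * x 1 + y 0 * y 1 \<le> p 0 * p 1 + q 0 * q 1"
    unfolding q by (simp add: algebra_simps)
qed

lemma dcx_leD:
  "dcx_le n M X N Y \<Longrightarrow> dcx n f \<Longrightarrow> integrable M (\<lambda>\<omega>. f (X \<omega>)) \<Longrightarrow> integrable N (\<lambda>\<omega>. f (Y \<omega>))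
    \<Longrightarrow> (\<integral>\<omega>. f (X \<omega>) \<partial>M) \<le> (\<integral>\<omega>. f (Y \<omega>) \<partial>N)"
  by (simp add: dcx_le_def)

lemma pp_dcx_le_first_moment_eq:
  assumes pp: "point_process M \<Phi>" "point_process N \<Psi>"
    and mf: "moment_finite M \<Phi> 1" "moment_finite N \<Psi> 1"
    and le: "pp_dcx_le M \<Phi> N \<Psi>" and A: "A \<in> sets borel" "bounded A"
  shows "(\<integral>\<^sup>+\<omega>. emeasure (\<Phi> \<omega>) A \<partial>M) = (\<integral>\<^sup>+\<omega>. emeasure (\<Psi> \<omega>) A \<partial>N)"
proof -
  have dcx_le: "dcx_le 1 M (count_vector \<Phi> 1 (\<lambda>_. A)) N (count_vector \<Psi> 1 (\<lambda>_. A))"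
    using le A by (simp add: pp_dcx_le_def)
  have int: "integrable M (\<lambda>\<omega>. measure (\<Phi> \<omega>) A)" "integrable N (\<lambda>\<omega>. measure (\<Psi> \<omega>) A)"
    using integrable_count pp mf A by blast+
  have *: "c * (\<integral>\<omega>. measure (\<Phi> \<omega>) A \<partial>M) \<le> c * (\<integral>\<omega>. measure (\<Psi> \<omega>) A \<partial>N)" for c
    using dcx_leD[OF dcx_le dcx_linear[of c]] int by (simp add: count_vector_def)
  have "(\<integral>\<omega>. measure (\<Phi> \<omega>) A \<partial>M) = (\<integral>\<omega>. measure (\<Psi> \<omega>) A \<partial>N)"
    using *[of 1] *[of "-1"] by simp
  then show ?thesis
    using nn_integral_count[OF pp(1) mf(1) A] nn_integral_count[OF pp(2) mf(2) A] by simp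
qed

lemma pp_dcx_le_second_moment_le:
  assumes pp: "point_process M \<Phi>" "point_process N \<Psi>"
    and mf: "moment_finite M \<Phi> 2" "moment_finite N \<Psi> 2"
    and le: "pp_dcx_le M \<Phi> N \<Psi>"
    and AB: "A \<in> sets borel" "bounded A" "B \<in> sets borel" "bounded B"
  shows "(\<integral>\<^sup>+\<omega>. emeasure (\<Phi> \<omega>) A * emeasure (\<Phi> \<omega>) B \<partial>M)
       \<le> (\<integral>\<^sup>+\<omega>. emeasure (\<Psi> \<omega>) A * emeasure (\<Psi> \<omega>) B \<partial>N)"
proof -
  let ?I = "\<lambda>i::nat. if i = 0 then A else B"
  have dcx_le: "dcx_le 2 M (count_vector \<Phi> 2 ?I) N (count_vector \<Psi> 2 ?I)"
    using le AB by (simp add: pp_dcx_le_def)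
  have int: "integrable M (\<lambda>\<omega>. measure (\<Phi> \<omega>) A * measure (\<Phi> \<omega>) B)"
    "integrable N (\<lambda>\<omega>. measure (\<Psi> \<omega>) A * measure (\<Psi> \<omega>) B)"
    using integrable_count_product pp mf AB by blast+
  have "(\<integral>\<omega>. measure (\<Phi> \<omega>) A * measure (\<Phi> \<omega>) B \<partial>M) \<le> (\<integral>\<omega>. measure (\<Psi> \<omega>) A * measure (\<Psi> \<omega>) B \<partial>N)"
    using dcx_leD[OF dcx_le dcx_product] int by (simp add: count_vector_def)
  then show ?thesis
    using nn_integral_count_product[OF pp(1) mf(1) AB] nn_integral_count_product[OF pp(2) mf(2) AB]
    by (simp add: ennreal_leI)
qed

section \<open>Product intensities in coordinates\<close>

lemma tuple1_measurable [measurable]: "tuple1 \<in> measurable borel (Pi\<^sub>M {..<1} (\<lambda>_. borel))"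
  unfolding tuple1_def by measurable

lemma tuple2_measurable [measurable]:
  "(\<lambda>(x, y). tuple2 x y) \<in> measurable
     (borel :: ('a::second_countable_topology \<times> 'a) measure) (Pi\<^sub>M {..<2} (\<lambda>_. borel))"
  unfolding tuple2_def split_beta borel_prod[symmetric]
  by (rule measurable_restrict) auto

text \<open>The intensities are functions on \<^typ>\<open>nat \<Rightarrow> 'a\<close>, integrated against a product over an
  index set, whereas pair correlations take two points. The maps \<^const>\<open>tuple1\<close> and
  \<^const>\<open>tuple2\<close> carry Lebesgue measure to these products, because the image measures have the
  right values on boxes.\<close>

lemma sets_PiM_lborel: "sets (Pi\<^sub>M I (\<lambda>_. lborel)) = sets (Pi\<^sub>M I (\<lambda>_. borel))"
  by (intro sets_PiM_cong) auto

lemma measurable_PiM_lborel: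
  "measurable lborel (Pi\<^sub>M I (\<lambda>_. lborel)) = measurable borel (Pi\<^sub>M I (\<lambda>_. borel))"
  "borel_measurable (Pi\<^sub>M I (\<lambda>_. lborel)) = borel_measurable (Pi\<^sub>M I (\<lambda>_. borel))"
  by (rule measurable_cong_sets; simp add: sets_PiM_lborel)+

lemma nn_integral_PiM_lborel_1:
  fixes f :: "(nat \<Rightarrow> 'a::euclidean_space) \<Rightarrow> ennreal"
  assumes "f \<in> borel_measurable (Pi\<^sub>M {..<1} (\<lambda>_. borel))"
  shows "(\<integral>\<^sup>+x. f x \<partial>(Pi\<^sub>M {..<1} (\<lambda>_. lborel))) = (\<integral>\<^sup>+x. f (tuple1 x) \<partial>lborel)"
proof -
  interpret product_sigma_finite "\<lambda>_::nat. lborel :: 'a measure" ..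
  have "{..<1::nat} = {0}"
    by auto
  then have distr: "distr lborel (Pi\<^sub>M {..<1} (\<lambda>_. lborel)) tuple1
      = Pi\<^sub>M {..<1} (\<lambda>_. lborel :: 'a measure)"
    using distr_component[of 0] unfolding tuple1_def[abs_def] by simp
  have "(\<integral>\<^sup>+x. f x \<partial>(distr lborel (Pi\<^sub>M {..<1} (\<lambda>_. lborel)) tuple1)) = (\<integral>\<^sup>+x. f (tuple1 x) \<partial>lborel)"
    using assms by (intro nn_integral_distr) (simp_all only: measurable_distr_eq1 measurable_PiM_lborel tuple1_measurable)
  then show ?thesis
    unfolding distr .
qed

lemma tuple2_in_PiE_iff: "tuple2 x y \<in> Pi\<^sub>E {..<2} A \<longleftrightarrow> x \<in> A 0 \<and> y \<in> A 1"
  by (auto simp: tuple2_def PiE_iff numeral_2_eq_2 less_Suc_eq)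

lemma nn_integral_PiM_lborel_2:
  fixes f :: "(nat \<Rightarrow> 'a::euclidean_space) \<Rightarrow> ennreal"
  assumes "f \<in> borel_measurable (Pi\<^sub>M {..<2} (\<lambda>_. borel))"
  shows "(\<integral>\<^sup>+x. f x \<partial>(Pi\<^sub>M {..<2} (\<lambda>_. lborel))) = (\<integral>\<^sup>+z. f (case z of (x, y) \<Rightarrow> tuple2 x y) \<partial>lborel)"
proof -
  interpret product_sigma_finite "\<lambda>_::nat. lborel :: 'a measure" ..
  let ?P = "Pi\<^sub>M {..<2::nat} (\<lambda>_. lborel :: 'a measure)"
  have t: "(\<lambda>(x, y). tuple2 x y) \<in> measurable lborel ?P"
    unfolding measurable_PiM_lborel by (rule tuple2_measurable)
  have distr: "distr lborel ?P (\<lambda>(x, y). tuple2 x y) = ?P"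
  proof (rule PiM_eqI)
    fix A :: "nat \<Rightarrow> 'a set" assume *: "\<And>i. i \<in> {..<2} \<Longrightarrow> A i \<in> sets lborel"
    then have A: "A 0 \<in> sets lborel" "A 1 \<in> sets lborel"
      by auto
    have "Pi\<^sub>E {..<2} A \<in> sets ?P"
      using * by (intro sets_PiM_I_finite) auto
    moreover have "(\<lambda>(x, y). tuple2 x y) -` Pi\<^sub>E {..<2} A = A 0 \<times> A 1"
      unfolding vimage_def split_beta tuple2_in_PiE_iff
      by (rule set_eqI) (simp add: mem_Times_iff)
    ultimately have "emeasure (distr lborel ?P (\<lambda>(x, y). tuple2 x y)) (Pi\<^sub>E {..<2} A)
        = emeasure lborel (A 0 \<times> A 1)"
      by (simp only: emeasure_distr[OF t] space_lborel space_borel Int_UNIV_right)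
    also have "\<dots> = emeasure (lborel \<Otimes>\<^sub>M lborel) (A 0 \<times> A 1)"
      by (simp only: lborel_prod)
    also have "\<dots> = emeasure lborel (A 0) * emeasure lborel (A 1)"
      using A by (rule lborel.emeasure_pair_measure_Times)
    finally show "emeasure (distr lborel ?P (\<lambda>(x, y). tuple2 x y)) (Pi\<^sub>E {..<2} A)
        = (\<Prod>i\<in>{..<2}. emeasure lborel (A i))"
      by (simp add: numeral_2_eq_2 lessThan_Suc mult.commute)
  qed simp_all
  have "(\<integral>\<^sup>+x. f x \<partial>(distr lborel ?P (\<lambda>(x, y). tuple2 x y)))
      = (\<integral>\<^sup>+z. f (case z of (x, y) \<Rightarrow> tuple2 x y) \<partial>lborel)"
    using assms by (intro nn_integral_distr t) (simp only: measurable_distr_eq1 measurable_PiM_lborel)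
  then show ?thesis
    unfolding distr .
qed

lemma product_intensity_1:
  assumes pp: "point_process M \<Phi>" and \<rho>: "product_intensity M \<Phi> 1 \<rho>" and A: "A \<in> sets borel"
  shows "(\<integral>\<^sup>+x\<in>A. ennreal (\<rho> (tuple1 x)) \<partial>lborel) = (\<integral>\<^sup>+\<omega>. emeasure (\<Phi> \<omega>) A \<partial>M)"
proof -
  let ?B = "\<Pi>\<^sub>E i\<in>{..<1::nat}. A"
  have [measurable]: "\<rho> \<in> borel_measurable (Pi\<^sub>M {..<1} (\<lambda>_. borel))"
    using \<rho> by (simp add: product_intensity_def)
  have B [measurable]: "?B \<in> sets (Pi\<^sub>M {..<1} (\<lambda>_. borel))"
    using A by (intro sets_PiM_I_finite) auto
  have "(\<integral>\<^sup>+\<omega>. emeasure (\<Phi> \<omega>) A \<partial>M) = moment_measure M \<Phi> 1 ?B"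
    using moment_measure_1[OF pp A] by simp
  also have "\<dots> = (\<integral>\<^sup>+x\<in>?B. ennreal (\<rho> x) \<partial>(Pi\<^sub>M {..<1} (\<lambda>_. lborel)))"
    using \<rho> B unfolding product_intensity_def by (auto simp: inj_on_def)
  also have "\<dots> = (\<integral>\<^sup>+x. ennreal (\<rho> (tuple1 x)) * indicator ?B (tuple1 x) \<partial>lborel)"
    by (rule nn_integral_PiM_lborel_1) measurable
  also have "\<dots> = (\<integral>\<^sup>+x\<in>A. ennreal (\<rho> (tuple1 x)) \<partial>lborel)"
    by (intro nn_integral_cong) (auto simp: indicator_def tuple1_def PiE_iff)
  finally show ?thesis
    by simp
qed

text \<open>Disjointness of \<open>A\<close> and \<open>B\<close> keeps \<open>A \<times> B\<close> off the diagonal, where the second moment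
  measure has mass from the pairs of a point with itself, which no density represents.\<close>

lemma product_intensity_2:
  fixes \<Phi> :: "'w \<Rightarrow> 'a::euclidean_space measure"
  assumes pp: "point_process M \<Phi>" and \<rho>: "product_intensity M \<Phi> 2 \<rho>"
    and A: "A \<in> sets borel" and B: "B \<in> sets borel" and disj: "A \<inter> B = {}"
  shows "(\<integral>\<^sup>+z\<in>A \<times> B. ennreal (\<rho> (tuple2 (fst z) (snd z))) \<partial>lborel)
    = (\<integral>\<^sup>+\<omega>. emeasure (\<Phi> \<omega>) A * emeasure (\<Phi> \<omega>) B \<partial>M)"
proof -
  let ?I = "\<lambda>i::nat. if i = 0 then A else B"
  let ?B = "Pi\<^sub>E {..<2::nat} ?I"
  have [measurable]: "\<rho> \<in> borel_measurable (Pi\<^sub>M {..<2} (\<lambda>_. borel))"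
    using \<rho> by (simp add: product_intensity_def)
  have B' [measurable]: "?B \<in> sets (Pi\<^sub>M {..<2} (\<lambda>_. borel))"
    using A B by (intro sets_PiM_I_finite) auto
  have off_diagonal: "?B \<subseteq> {x. inj_on x {..<2}}"
  proof
    fix x assume x: "x \<in> ?B"
    have "x 0 \<in> A" "x 1 \<in> B"
      using PiE_mem[OF x, of 0] PiE_mem[OF x, of 1] by simp_all
    then have "x 0 \<noteq> x 1"
      using disj by auto
    then show "x \<in> {x. inj_on x {..<2}}"
      by (auto simp: inj_on_def numeral_2_eq_2 less_Suc_eq)
  qed
  have "(\<integral>\<^sup>+\<omega>. emeasure (\<Phi> \<omega>) A * emeasure (\<Phi> \<omega>) B \<partial>M) = moment_measure M \<Phi> 2 ?B"
    using moment_measure_2[OF pp A B] by simp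
  also have "\<dots> = (\<integral>\<^sup>+x\<in>?B. ennreal (\<rho> x) \<partial>(Pi\<^sub>M {..<2} (\<lambda>_. lborel)))"
    using \<rho> B' off_diagonal unfolding product_intensity_def by blast
  also have "\<dots> = (\<integral>\<^sup>+z. ennreal (\<rho> (case z of (x, y) \<Rightarrow> tuple2 x y))
      * indicator ?B (case z of (x, y) \<Rightarrow> tuple2 x y) \<partial>lborel)"
    by (rule nn_integral_PiM_lborel_2) measurable
  also have "\<dots> = (\<integral>\<^sup>+z\<in>A \<times> B. ennreal (\<rho> (tuple2 (fst z) (snd z))) \<partial>lborel)"
  proof (intro nn_integral_cong)
    fix z :: "'a \<times> 'a"
    have "(case z of (x, y) \<Rightarrow> tuple2 x y) \<in> ?B \<longleftrightarrow> z \<in> A \<times> B"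
      by (cases z) (simp add: tuple2_in_PiE_iff)
    then show "ennreal (\<rho> (case z of (x, y) \<Rightarrow> tuple2 x y)) * indicator ?B (case z of (x, y) \<Rightarrow> tuple2 x y)
        = ennreal (\<rho> (tuple2 (fst z) (snd z))) * indicator (A \<times> B) z"
      by (simp add: indicator_def split_beta)
  qed
  finally show ?thesis
    by simp
qed

lemma pp_dcx_le_first_intensity_eq:
  fixes \<Phi> :: "'v \<Rightarrow> 'a::euclidean_space measure" and \<Psi> :: "'w \<Rightarrow> 'a measure"
  assumes pp: "point_process M \<Phi>" "point_process N \<Psi>"
    and mf: "moment_finite M \<Phi> 1" "moment_finite N \<Psi> 1"
    and \<rho>: "product_intensity M \<Phi> 1 \<rho>" and \<sigma>: "product_intensity N \<Psi> 1 \<sigma>"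
    and le: "pp_dcx_le M \<Phi> N \<Psi>"
  shows "AE x in lborel. \<rho> (tuple1 x) = \<sigma> (tuple1 x)"
proof -
  have meas [measurable]: "\<rho> \<in> borel_measurable (Pi\<^sub>M {..<1} (\<lambda>_. borel))"
    "\<sigma> \<in> borel_measurable (Pi\<^sub>M {..<1} (\<lambda>_. borel))"
    using \<rho> \<sigma> by (auto simp: product_intensity_def)
  have nonneg: "0 \<le> \<rho> (tuple1 x)" "0 \<le> \<sigma> (tuple1 x)" for x
    using \<rho> \<sigma> by (auto simp: product_intensity_def tuple1_def)
  have bounded_eq: "(\<integral>\<^sup>+x\<in>A. ennreal (\<rho> (tuple1 x)) \<partial>lborel) = (\<integral>\<^sup>+x\<in>A. ennreal (\<sigma> (tuple1 x)) \<partial>lborel)"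
    if "A \<in> sets borel" "bounded A" for A
    using that product_intensity_1[OF pp(1) \<rho>] product_intensity_1[OF pp(2) \<sigma>]
      pp_dcx_le_first_moment_eq[OF pp mf le] by simp
  \<comment> \<open>The mean measures are finite on bounded sets only, so the densities are compared on balls.\<close>
  have "AE x in lborel. x \<in> ball 0 (real n) \<longrightarrow> \<rho> (tuple1 x) = \<sigma> (tuple1 x)" for n
  proof -
    define U :: "'a set" where "U = ball 0 (real n)"
    have [measurable]: "U \<in> sets borel" and "bounded U"
      by (auto simp: U_def)
    define f g where "f x = ennreal (\<rho> (tuple1 x)) * indicator U x"
      and "g x = ennreal (\<sigma> (tuple1 x)) * indicator U x" for x
    have [measurable]: "f \<in> borel_measurable lborel" "g \<in> borel_measurable lborel"
      unfolding f_def g_def by measurable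
    have eq: "(\<integral>\<^sup>+x\<in>A. f x \<partial>lborel) = (\<integral>\<^sup>+x\<in>A. g x \<partial>lborel)" if "A \<in> sets lborel" for A
      using bounded_eq[of "U \<inter> A"] that \<open>bounded U\<close>
      by (simp add: f_def g_def indicator_inter_arith mult.assoc bounded_Int)
    have fin: "(\<integral>\<^sup>+x. f x \<partial>lborel) < \<infinity>"
      unfolding f_def using first_moment_finite[OF pp(1) mf(1) _ \<open>bounded U\<close>]
      by (subst product_intensity_1[OF pp(1) \<rho>]) auto
    have "AE x in lborel. f x \<le> g x"
      by (rule AE_le_of_set_nn_integral_le) (use fin eq in auto)
    moreover have "AE x in lborel. g x \<le> f x"
      by (rule AE_le_of_set_nn_integral_le) (use fin eq eq[of UNIV] in auto)
    ultimately show ?thesis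
      by eventually_elim (auto simp: f_def g_def U_def[symmetric] nonneg intro: antisym)
  qed
  then have "AE x in lborel. \<forall>n. x \<in> ball 0 (real n) \<longrightarrow> \<rho> (tuple1 x) = \<sigma> (tuple1 x)"
    by (simp only: AE_all_countable) blast
  then show ?thesis
  proof eventually_elim
    fix x :: 'a assume *: "\<forall>n. x \<in> ball 0 (real n) \<longrightarrow> \<rho> (tuple1 x) = \<sigma> (tuple1 x)"
    obtain n :: nat where "norm x < real n"
      using reals_Archimedean2 by blast
    with * show "\<rho> (tuple1 x) = \<sigma> (tuple1 x)"
      by (auto simp: dist_norm)
  qed
qed

lemma AE_lborel_off_diagonal: "AE z in (lborel :: ('a::euclidean_space \<times> 'a) measure). fst z \<noteq> snd z"
proof -
  have "AE z in (lborel :: 'a measure) \<Otimes>\<^sub>M (lborel :: 'a measure). fst z \<noteq> snd z"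
  proof (rule lborel_pair.AE_pair_measure)
    show "{z \<in> space ((lborel :: 'a measure) \<Otimes>\<^sub>M lborel). fst z \<noteq> snd z} \<in> sets (lborel \<Otimes>\<^sub>M lborel)"
      by measurable
    show "AE x in (lborel :: 'a measure). AE y in lborel. fst (x, y) \<noteq> snd (x, y)"
    proof (rule AE_I2)
      fix x :: 'a
      show "AE y in lborel. fst (x, y) \<noteq> snd (x, y)"
        using AE_lborel_singleton[of x] by eventually_elim auto
    qed
  qed
  then show ?thesis
    unfolding lborel_prod .
qed

text \<open>Boundedness of the factors is what makes second moments finite on each product, and
  disjointness is what makes the second intensity available there.\<close>

lemma off_diagonal_countable_cover:
  obtains \<C> :: "('a::{metric_space, second_countable_topology} set \<times> 'a set) set"
  where "countable \<C>"
    and "\<And>U V. (U, V) \<in> \<C> \<Longrightarrow> open U \<and> bounded U \<and> open V \<and> bounded V \<and> U \<inter> V = {}"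
    and "\<And>x y. x \<noteq> y \<Longrightarrow> \<exists>(U, V)\<in>\<C>. x \<in> U \<and> y \<in> V"
proof -
  obtain \<B> :: "'a set set" where B: "countable \<B>" "topological_basis \<B>"
    using ex_countable_basis by blast
  define \<C> where "\<C> = {(U, V) \<in> \<B> \<times> \<B>. bounded U \<and> bounded V \<and> U \<inter> V = {}}"
  have cover: "\<exists>(U, V)\<in>\<C>. x \<in> U \<and> y \<in> V" if "x \<noteq> y" for x y
  proof -
    obtain U' V' where UV': "open U'" "open V'" "x \<in> U'" "y \<in> V'" "U' \<inter> V' = {}"
      using hausdorff[OF \<open>x \<noteq> y\<close>] by blast
    obtain U where U: "U \<in> \<B>" "x \<in> U" "U \<subseteq> U' \<inter> ball x 1"
      using topological_basisE[OF B(2), of "U' \<inter> ball x 1" x] UV' by auto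
    obtain V where V: "V \<in> \<B>" "y \<in> V" "V \<subseteq> V' \<inter> ball y 1"
      using topological_basisE[OF B(2), of "V' \<inter> ball y 1" y] UV' by auto
    have "bounded U" "bounded V"
      using U V by (meson bounded_ball bounded_subset le_inf_iff)+
    with U V UV' have "(U, V) \<in> \<C>"
      by (auto simp: \<C>_def)
    with U V show ?thesis
      by blast
  qed
  show thesis
  proof (rule that)
    show "countable \<C>"
      by (rule countable_subset[of _ "\<B> \<times> \<B>"]) (auto simp: \<C>_def B(1))
    show "open U \<and> bounded U \<and> open V \<and> bounded V \<and> U \<inter> V = {}" if "(U, V) \<in> \<C>" for U V
      using that topological_basis_open[OF B(2)] by (auto simp: \<C>_def)
  qed (rule cover)
qed

lemma pp_dcx_le_second_intensity_le:
  fixes \<Phi> :: "'v \<Rightarrow> 'a::euclidean_space measure" and \<Psi> :: "'w \<Rightarrow> 'a measure"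
  assumes pp: "point_process M \<Phi>" "point_process N \<Psi>"
    and mf: "moment_finite M \<Phi> 2" "moment_finite N \<Psi> 2"
    and \<rho>: "product_intensity M \<Phi> 2 \<rho>" and \<sigma>: "product_intensity N \<Psi> 2 \<sigma>"
    and le: "pp_dcx_le M \<Phi> N \<Psi>"
  shows "AE z in lborel. \<rho> (tuple2 (fst z) (snd z)) \<le> \<sigma> (tuple2 (fst z) (snd z))"
proof -
  have [measurable]: "\<rho> \<in> borel_measurable (Pi\<^sub>M {..<2} (\<lambda>_. borel))"
    "\<sigma> \<in> borel_measurable (Pi\<^sub>M {..<2} (\<lambda>_. borel))"
    using \<rho> \<sigma> by (auto simp: product_intensity_def)
  have t [measurable]: "(\<lambda>z. tuple2 (fst z) (snd z)) \<in> measurable (borel :: ('a \<times> 'a) measure) (Pi\<^sub>M {..<2} (\<lambda>_. borel))"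
    using tuple2_measurable by (simp add: split_beta')
  have nonneg: "0 \<le> \<sigma> (tuple2 x y)" for x y
    using \<sigma> by (auto simp: product_intensity_def tuple2_def)
  obtain \<C> :: "('a set \<times> 'a set) set" where C: "countable \<C>"
    "\<And>U V. (U, V) \<in> \<C> \<Longrightarrow> open U \<and> bounded U \<and> open V \<and> bounded V \<and> U \<inter> V = {}"
    "\<And>x y. x \<noteq> y \<Longrightarrow> \<exists>(U, V)\<in>\<C>. x \<in> U \<and> y \<in> V"
    using off_diagonal_countable_cover by blast
  have "AE z in lborel. z \<in> U \<times> V \<longrightarrow>
      ennreal (\<rho> (tuple2 (fst z) (snd z))) \<le> ennreal (\<sigma> (tuple2 (fst z) (snd z)))"
    if "(U, V) \<in> \<C>" for U V
  proof (rule AE_le_of_rectangle_integrals_le)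
    have UV: "U \<in> sets borel" "bounded U" "V \<in> sets borel" "bounded V" "U \<inter> V = {}"
      using C(2)[OF that] by auto
    then show "U \<in> sets borel" "V \<in> sets borel"
      by auto
    show "(\<integral>\<^sup>+z\<in>U \<times> V. ennreal (\<sigma> (tuple2 (fst z) (snd z))) \<partial>lborel) < \<infinity>"
      using UV by (subst product_intensity_2[OF pp(2) \<sigma>]) (auto intro: second_moment_finite[OF pp(2) mf(2), simplified])
    fix A B assume AB: "A \<in> sets borel" "B \<in> sets borel" "A \<subseteq> U" "B \<subseteq> V"
    then have "bounded A" "bounded B" "A \<inter> B = {}"
      using UV bounded_subset by blast+
    then show "(\<integral>\<^sup>+z\<in>A \<times> B. ennreal (\<rho> (tuple2 (fst z) (snd z))) \<partial>lborel)
        \<le> (\<integral>\<^sup>+z\<in>A \<times> B. ennreal (\<sigma> (tuple2 (fst z) (snd z))) \<partial>lborel)"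
      using AB product_intensity_2[OF pp(1) \<rho>] product_intensity_2[OF pp(2) \<sigma>]
        pp_dcx_le_second_moment_le[OF pp mf le] by simp
  qed measurable
  then have "AE z in lborel. \<forall>c\<in>\<C>. z \<in> fst c \<times> snd c \<longrightarrow>
      ennreal (\<rho> (tuple2 (fst z) (snd z))) \<le> ennreal (\<sigma> (tuple2 (fst z) (snd z)))"
    using C(1) by (subst AE_ball_countable) auto
  with AE_lborel_off_diagonal show ?thesis
  proof eventually_elim
    fix z :: "'a \<times> 'a"
    assume "fst z \<noteq> snd z" and *: "\<forall>c\<in>\<C>. z \<in> fst c \<times> snd c \<longrightarrow>
      ennreal (\<rho> (tuple2 (fst z) (snd z))) \<le> ennreal (\<sigma> (tuple2 (fst z) (snd z)))"
    then obtain U V where "(U, V) \<in> \<C>" "fst z \<in> U" "snd z \<in> V"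
      using C(3) by blast
    with * have "ennreal (\<rho> (tuple2 (fst z) (snd z))) \<le> ennreal (\<sigma> (tuple2 (fst z) (snd z)))"
      by (force simp: mem_Times_iff)
    then show "\<rho> (tuple2 (fst z) (snd z)) \<le> \<sigma> (tuple2 (fst z) (snd z))"
      using nonneg by simp
  qed
qed

text \<open>The set where \<open>P\<close> fails need not be measurable, so it is first enlarged to a Borel null
  set, to which Fubini's theorem applies.\<close>

lemma AE_lborel_both_coordinates:
  fixes P :: "'a::euclidean_space \<Rightarrow> bool"
  assumes "AE x in lborel. P x"
  shows "AE z in lborel. P (fst z) \<and> P (snd z)"
proof -
  obtain S where S: "S \<in> null_sets (lborel :: 'a measure)" "{x. \<not> P x} \<subseteq> S"
    using assms by (auto simp: eventually_ae_filter)
  then have Sm [measurable]: "S \<in> sets borel"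
    by (auto simp: null_sets_def)
  have notS: "AE x in lborel. x \<notin> S"
    using S(1) by (rule AE_not_in)
  have "AE z in (lborel :: 'a measure) \<Otimes>\<^sub>M (lborel :: 'a measure). fst z \<notin> S \<and> snd z \<notin> S"
  proof (rule lborel_pair.AE_pair_measure)
    show "{z \<in> space ((lborel :: 'a measure) \<Otimes>\<^sub>M (lborel :: 'a measure)). fst z \<notin> S \<and> snd z \<notin> S}
        \<in> sets (lborel \<Otimes>\<^sub>M lborel)"
      by measurable
    show "AE x in lborel. AE y in lborel. fst (x, y) \<notin> S \<and> snd (x, y) \<notin> S"
      using notS by eventually_elim (use notS in auto)
  qed
  then have "AE z in (lborel :: ('a \<times> 'a) measure). fst z \<notin> S \<and> snd z \<notin> S"
    unfolding lborel_prod .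
  then show ?thesis
    by eventually_elim (use S(2) in auto)
qed

theorem corollary3p1:
  fixes M\<^sub>1 :: "'v measure" and M\<^sub>2 :: "'w measure"
    and \<Phi>\<^sub>1 :: "'v \<Rightarrow> 'a::euclidean_space measure" and \<Phi>\<^sub>2 :: "'w \<Rightarrow> 'a measure"
    and \<rho>\<^sub>1\<^sub>1 \<rho>\<^sub>1\<^sub>2 \<rho>\<^sub>2\<^sub>1 \<rho>\<^sub>2\<^sub>2 :: "(nat \<Rightarrow> 'a) \<Rightarrow> real"
  assumes "point_process M\<^sub>1 \<Phi>\<^sub>1" and "point_process M\<^sub>2 \<Phi>\<^sub>2"
    and "\<And>k. k \<in> {1, 2} \<Longrightarrow> moment_finite M\<^sub>1 \<Phi>\<^sub>1 k"
    and "\<And>k. k \<in> {1, 2} \<Longrightarrow> moment_finite M\<^sub>2 \<Phi>\<^sub>2 k"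
    and "product_intensity M\<^sub>1 \<Phi>\<^sub>1 1 \<rho>\<^sub>1\<^sub>1" and "product_intensity M\<^sub>1 \<Phi>\<^sub>1 2 \<rho>\<^sub>1\<^sub>2"
    and "product_intensity M\<^sub>2 \<Phi>\<^sub>2 1 \<rho>\<^sub>2\<^sub>1" and "product_intensity M\<^sub>2 \<Phi>\<^sub>2 2 \<rho>\<^sub>2\<^sub>2"
    and "pp_dcx_le M\<^sub>1 \<Phi>\<^sub>1 M\<^sub>2 \<Phi>\<^sub>2"
  shows "AE (x, y) in (lborel :: ('a \<times> 'a) measure).
           pair_correlation_defined \<rho>\<^sub>1\<^sub>1 x y \<and> pair_correlation_defined \<rho>\<^sub>2\<^sub>1 x y \<longrightarrow>
           pair_correlation \<rho>\<^sub>1\<^sub>1 \<rho>\<^sub>1\<^sub>2 x y \<le> pair_correlation \<rho>\<^sub>2\<^sub>1 \<rho>\<^sub>2\<^sub>2 x y"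
proof -
  have "AE x in lborel. \<rho>\<^sub>1\<^sub>1 (tuple1 x) = \<rho>\<^sub>2\<^sub>1 (tuple1 x)"
    using assms by (intro pp_dcx_le_first_intensity_eq) auto
  then have "AE z in lborel. \<rho>\<^sub>1\<^sub>1 (tuple1 (fst z)) = \<rho>\<^sub>2\<^sub>1 (tuple1 (fst z))
      \<and> \<rho>\<^sub>1\<^sub>1 (tuple1 (snd z)) = \<rho>\<^sub>2\<^sub>1 (tuple1 (snd z))"
    by (rule AE_lborel_both_coordinates)
  moreover have "AE z in lborel. \<rho>\<^sub>1\<^sub>2 (tuple2 (fst z) (snd z)) \<le> \<rho>\<^sub>2\<^sub>2 (tuple2 (fst z) (snd z))"
    using assms by (intro pp_dcx_le_second_intensity_le) auto
  ultimately show ?thesis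
    by eventually_elim
      (auto simp: pair_correlation_def pair_correlation_defined_def intro!: divide_right_mono)
qed

end
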